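(* Let $c>0$ be real and let $\delta\ge1$ be an integer. There exists a bijection between the set of distribution functions $F\in\mathbf{P}_{c,\delta}$ with $\mathrm{supp}(F)=\mathbb{Z}_+=\{0,1,2,\ldots\}$ and the set of positive solutions $y:\mathbb{Z}_+\to\mathbb{R}$ (that is, $y(i)>0$ for all $i\in\mathbb{Z}_+$) of the discrete initial value problem $$\Delta y(i)+cy(i-\delta)=0,\ i\ge\delta;\qquad y(i)=\varphi(i),\ i=0,\ldots,\delta,$$ with initial function $\varphi\in\Phi_d$. The bijection is given by $F=1-y$ (i.e. $F(i)=1-y(i)$ for $i\in\mathbb{Z}_+$). In particular, there is no $F\in\mathbf{P}_{c,\delta}$ with $\mathrm{supp}(F)=\mathbb{Z}_+$ if and only if $c\delta>\left(\frac{\delta}{\delta+1}\right)^{\delta+1}$.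
   Context: Let $(X_n)_{n\ge1}$ be independent, identically distributed, integrable real random variables with non-degenerate distribution function $F$. Put $\mathcal{F}_n=\sigma(X_1,\ldots,X_n)$ and $M_n=\max\{X_1,\ldots,X_n\}$. For a real $\delta\neq0$ let $I_1=1$ and, for $n\ge2$, let $I_n=1$ if $X_n>M_{n-1}+\delta$ and $I_n=0$ otherwise; let $N_n=\sum_{k=1}^n I_k$ (the number of $\delta$-records among the first $n$ observations). For real $c>0$ and $\delta\ne0$, write $F\in\mathbf{P}_{c,\delta}$ if $F$ is such a (non-degenerate, finite-mean) distribution function and $(N_n-cM_n)_{n\ge1}$ is an $(\mathcal{F}_n)$-martingale. The support is $\mathrm{supp}(F)=\{x\in\mathbb{R}:F(x+\epsilon)-F(x-\epsilon)>0\ \forall\epsilon>0\}$. $\Delta y(i)=y(i+1)-y(i)$ is the forward difference. $\Phi_d$ denotes the set of strictly decreasing functions $\varphi:\{0,1,\ldots,\delta\}\to(0,1)$. A distribution function with support $\mathbb{Z}_+$ is identified with its values on $\mathbb{Z}_+$ (so $F(x)=F(\lfloor x\rfloor)$ for $x\ge0$ and $F(x)=0$ for $x<0$). *)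

theory Defs
  imports "HOL-Probability.Probability"
begin

definition generated_filtration :: "'a measure \<Rightarrow> (nat \<Rightarrow> 'a \<Rightarrow> real) \<Rightarrow> nat \<Rightarrow> 'a measure" where
  "generated_filtration M X n =
     sigma (space M) (\<Union>i\<in>{1..n}. {X i -` B \<inter> space M | B. B \<in> sets borel})"

definition martingale_on :: "'a measure \<Rightarrow> nat set \<Rightarrow> (nat \<Rightarrow> 'a measure) \<Rightarrow> (nat \<Rightarrow> 'a \<Rightarrow> real) \<Rightarrow> bool" where
  "martingale_on M T \<F> Z \<longleftrightarrow>
     (\<forall>n\<in>T. subalgebra M (\<F> n)) \<and>
     (\<forall>m\<in>T. \<forall>n\<in>T. m \<le> n \<longrightarrow> sets (\<F> m) \<subseteq> sets (\<F> n)) \<and>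
     (\<forall>n\<in>T. Z n \<in> borel_measurable (\<F> n) \<and> integrable M (Z n)) \<and>
     (\<forall>m\<in>T. \<forall>n\<in>T. m \<le> n \<longrightarrow> (AE \<omega> in M. real_cond_exp M (\<F> m) (Z n) \<omega> = Z m \<omega>))"

text \<open>Observations are indexed from 1; the value at index 0 of a sequence plays no role.\<close>

definition running_max :: "(nat \<Rightarrow> 'a \<Rightarrow> real) \<Rightarrow> nat \<Rightarrow> 'a \<Rightarrow> real" where
  "running_max X n \<omega> = Max ((\<lambda>i. X i \<omega>) ` {1..n})"

definition delta_record_ind :: "real \<Rightarrow> (nat \<Rightarrow> 'a \<Rightarrow> real) \<Rightarrow> nat \<Rightarrow> 'a \<Rightarrow> real" where
  "delta_record_ind \<delta> X n \<omega> =
     (if n = 1 then 1 else if X n \<omega> > running_max X (n - 1) \<omega> + \<delta> then 1 else 0)"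

definition delta_record_count :: "real \<Rightarrow> (nat \<Rightarrow> 'a \<Rightarrow> real) \<Rightarrow> nat \<Rightarrow> 'a \<Rightarrow> real" where
  "delta_record_count \<delta> X n \<omega> = (\<Sum>k = 1..n. delta_record_ind \<delta> X k \<omega>)"

definition iid_with_cdf :: "'a measure \<Rightarrow> (nat \<Rightarrow> 'a \<Rightarrow> real) \<Rightarrow> (real \<Rightarrow> real) \<Rightarrow> bool" where
  "iid_with_cdf M X F \<longleftrightarrow>
     prob_space M \<and>
     prob_space.indep_vars M (\<lambda>_. borel) X {1..} \<and>
     (\<forall>n\<ge>1. cdf (distr M borel (X n)) = F)"

definition nondegenerate :: "(real \<Rightarrow> real) \<Rightarrow> bool" where
  "nondegenerate F \<longleftrightarrow> \<not> (\<exists>a. \<forall>x. F x = (if x < a then 0 else 1))"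

text \<open>
  The defining property depends only on the joint law of the sequence, hence only on \<open>F\<close>. The
  underlying probability space is therefore quantified existentially; its type \<open>nat \<Rightarrow> real\<close> is no
  restriction, because every i.i.d. real sequence is realised by the coordinates of a product
  measure on that type.
\<close>

definition P :: "real \<Rightarrow> real \<Rightarrow> (real \<Rightarrow> real) set" where
  "P c \<delta> = {F. nondegenerate F \<and>
     (\<exists>(M :: (nat \<Rightarrow> real) measure) X.
        iid_with_cdf M X F \<and>
        (\<forall>n\<ge>1. integrable M (X n)) \<and>
        martingale_on M {1..} (generated_filtration M X)
          (\<lambda>n \<omega>. delta_record_count \<delta> X n \<omega> - c * running_max X n \<omega>))}"

definition supp :: "(real \<Rightarrow> real) \<Rightarrow> real set" where
  "supp F = {x. \<forall>\<epsilon>>0. F (x + \<epsilon>) - F (x - \<epsilon>) > 0}"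

definition fwd_diff :: "(nat \<Rightarrow> real) \<Rightarrow> nat \<Rightarrow> real" where
  "fwd_diff y i = y (i + 1) - y i"

definition Phi_d :: "nat \<Rightarrow> (nat \<Rightarrow> real) set" where
  "Phi_d \<delta> = {\<phi> \<in> {0..\<delta>} \<rightarrow>\<^sub>E {0<..<1}. strict_antimono_on {0..\<delta>} \<phi>}"

definition solves_ivp :: "real \<Rightarrow> nat \<Rightarrow> (nat \<Rightarrow> real) \<Rightarrow> (nat \<Rightarrow> real) \<Rightarrow> bool" where
  "solves_ivp c \<delta> \<phi> y \<longleftrightarrow>
     (\<forall>i\<ge>\<delta>. fwd_diff y i + c * y (i - \<delta>) = 0) \<and> (\<forall>i\<in>{0..\<delta>}. y i = \<phi> i)"

definition positive_solutions :: "real \<Rightarrow> nat \<Rightarrow> (nat \<Rightarrow> real) set" where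
  "positive_solutions c \<delta> = {y. (\<forall>i. y i > 0) \<and> (\<exists>\<phi>\<in>Phi_d \<delta>. solves_ivp c \<delta> \<phi> y)}"

end

theory Submission
  imports Defs
begin

text \<open>
  Write \<open>y = 1 - F\<close>. Passing from \<open>n\<close> to \<open>n + 1\<close> changes \<open>N - c M\<close> by
  \<open>1{X > m + \<delta>} - c (X - m)\<^sup>+\<close>, where \<open>m\<close> is the current maximum and \<open>X\<close> the new observation
  (\<open>record_gain\<close>). As \<open>X\<close> is independent of the past, the martingale property says that this
  quantity has mean zero for every level \<open>m\<close> that the maximum attains with positive probability. If
  \<open>F\<close> has support \<open>\<nat>\<close>, the maximum lives on \<open>\<nat>\<close> and every level \<open>i\<close> is attained already at time 1
  (\<open>martingale_imp_expected_gain_0\<close>, \<open>expected_gain_0_imp_martingale\<close>), so membership in \<open>P c \<delta>\<close>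
  is a condition on the law of one observation (\<open>mem_P_iff\<close>).

  For two neighbouring levels the positive parts differ by \<open>1{X > i}\<close>, so the difference of the two
  means is \<open>y(i + \<delta>) - y(i + \<delta> + 1) - c y(i)\<close>: the delay difference equation says exactly that the
  mean gain does not depend on the level. Since the mean gain tends to 0 as the level grows, this
  amounts to its being zero (\<open>expectation_record_gain_zero_iff\<close>). Conversely, a positive solution is
  strictly decreasing, and telescoping the equation bounds its partial sums by \<open>y(\<delta>) / c\<close>; so it is
  summable, hence tends to 0, and it is the tail of a probability distribution on \<open>\<nat>\<close> with finite
  mean (\<open>distribution_of_survival_sequence\<close>). The i.i.d. sequence is then a product measure.

  For the existence criterion, the maximum of \<open>s\<^sup>\<delta> (1 - s)\<close> over \<open>s > 0\<close> is
  \<open>b = (\<delta> / (\<delta> + 1)) ^ (\<delta> + 1) / \<delta>\<close>, by Bernoulli's inequality. If \<open>c \<le> b\<close>, the characteristic equation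
  \<open>r\<^sup>\<delta> (1 - r) = c\<close> has a root in \<open>(0, 1)\<close> and powers of \<open>r\<close> solve the problem. If \<open>c > b\<close>, an upper
  bound \<open>s\<close> for the ratios \<open>y(i + 1) / y(i)\<close> improves to \<open>s - (c - b)\<close> after \<open>\<delta>\<close> steps, which
  eventually contradicts positivity (\<open>ratio_decay\<close>).
\<close>

section \<open>Positive solutions of the delay difference equation\<close>

text \<open>
  The initial function carries no information beyond \<open>y\<close> itself. Its monotonicity extends to all of
  \<open>y\<close>, because from \<open>\<delta>\<close> on the equation subtracts a positive quantity in each step.
\<close>

lemma positive_solutions_iff:
  assumes "c > 0"
  shows "y \<in> positive_solutions c \<delta> \<longleftrightarrow>
    (\<forall>i. 0 < y i) \<and> y 0 < 1 \<and> (\<forall>i. y (Suc i) < y i) \<and>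
    (\<forall>i. y (Suc (i + \<delta>)) = y (i + \<delta>) - c * y i)"
proof
  assume "y \<in> positive_solutions c \<delta>"
  then obtain \<phi> where pos: "\<And>i. 0 < y i" and \<phi>: "\<phi> \<in> Phi_d \<delta>" and ivp: "solves_ivp c \<delta> \<phi> y"
    unfolding positive_solutions_def by auto
  have agree: "y i = \<phi> i" if "i \<le> \<delta>" for i
    using ivp that unfolding solves_ivp_def by auto
  have step: "y (Suc (i + \<delta>)) = y (i + \<delta>) - c * y i" for i
  proof -
    have "fwd_diff y (i + \<delta>) + c * y (i + \<delta> - \<delta>) = 0"
      using ivp unfolding solves_ivp_def by (meson le_add2)
    then show ?thesis by (simp add: fwd_diff_def)
  qed
  have "y (Suc i) < y i" for i
  proof (cases "Suc i \<le> \<delta>")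
    case True
    have "strict_antimono_on {0..\<delta>} \<phi>" using \<phi> unfolding Phi_d_def by blast
    then have "\<phi> (Suc i) < \<phi> i"
      using True by (auto simp: monotone_on_def)
    then show ?thesis using True by (simp add: agree)
  next
    case False
    then obtain j where "i = j + \<delta>" by (metis le_add_diff_inverse2 not_less_eq_eq)
    then show ?thesis using step[of j] pos[of j] \<open>c > 0\<close> by simp
  qed
  moreover have "y 0 < 1"
    using agree[of 0] \<phi> unfolding Phi_d_def by (auto simp: PiE_iff)
  ultimately show "(\<forall>i. 0 < y i) \<and> y 0 < 1 \<and> (\<forall>i. y (Suc i) < y i) \<and>
    (\<forall>i. y (Suc (i + \<delta>)) = y (i + \<delta>) - c * y i)"
    using pos step by blast
next
  assume y: "(\<forall>i. 0 < y i) \<and> y 0 < 1 \<and> (\<forall>i. y (Suc i) < y i) \<and>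
    (\<forall>i. y (Suc (i + \<delta>)) = y (i + \<delta>) - c * y i)"
  have less: "y j < y i" if "i < j" for i j
    using that by (induction rule: less_Suc_induct) (use y in \<open>auto intro: less_trans\<close>)
  have "y i < 1" for i
    using less[of 0 i] y by (cases i) (auto intro: less_trans)
  then have "restrict y {0..\<delta>} \<in> Phi_d \<delta>"
    using y less by (auto simp: Phi_d_def monotone_on_def)
  moreover have "solves_ivp c \<delta> (restrict y {0..\<delta>}) y"
    unfolding solves_ivp_def
  proof (intro conjI allI impI)
    fix i assume "\<delta> \<le> i"
    then obtain j where "i = j + \<delta>" by (metis le_add_diff_inverse2)
    then show "fwd_diff y i + c * y (i - \<delta>) = 0"
      using y by (simp add: fwd_diff_def)
  qed auto
  ultimately show "y \<in> positive_solutions c \<delta>"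
    using y unfolding positive_solutions_def by blast
qed

text \<open>
  Summing the equation gives \<open>c * (y 0 + \<dots> + y (n - 1)) = y \<delta> - y (n + \<delta>)\<close>.
\<close>

lemma positive_solution_summable:
  assumes "c > 0" "y \<in> positive_solutions c \<delta>"
  shows "summable y"
proof -
  have y: "\<And>i. 0 < y i" "\<And>i. y (Suc (i + \<delta>)) = y (i + \<delta>) - c * y i"
    using assms positive_solutions_iff by auto
  have "(\<Sum>i<n. y i) \<le> y \<delta> / c" for n
  proof -
    have "c * (\<Sum>i<n. y i) = y \<delta> - y (n + \<delta>)"
      by (induction n) (simp_all add: y(2) algebra_simps)
    then have "c * (\<Sum>i<n. y i) \<le> y \<delta>"
      using y(1)[of "n + \<delta>"] by linarith
    then show ?thesis
      using \<open>c > 0\<close> by (simp add: field_simps)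
  qed
  then show ?thesis
    using y(1) by (intro summableI_nonneg_bounded[of _ "y \<delta> / c"]) (auto intro: less_imp_le)
qed

text \<open>
  The maximum is attained at \<open>m = n / (n + 1)\<close>. With \<open>s = m * t\<close> the claim becomes
  \<open>(n + 1) * t ^ n - n * t ^ (n + 1) \<le> 1\<close>, which is Bernoulli's inequality for \<open>(1 / t) ^ (n + 1)\<close>
  multiplied by \<open>t ^ (n + 1)\<close>.
\<close>

lemma power_times_one_minus_le:
  fixes s :: real
  assumes "0 < s"
  shows "real n * (s ^ n * (1 - s)) \<le> (real n / (real n + 1)) ^ (n + 1)"
proof (cases "n = 0")
  case False
  define m where "m = real n / (real n + 1)"
  define t where "t = s / m"
  have m: "m > 0" and t: "t > 0" and s: "s = m * t"
    using False assms by (auto simp: m_def t_def)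
  have "1 + real (n + 1) * (1 / t - 1) \<le> (1 + (1 / t - 1)) ^ (n + 1)"
    using t by (intro Bernoulli_inequality) simp
  then have "(1 + real (n + 1) * (1 / t - 1)) * t ^ (n + 1) \<le> (1 / t) ^ (n + 1) * t ^ (n + 1)"
    using t by (intro mult_right_mono) auto
  also have "(1 / t) ^ (n + 1) * t ^ (n + 1) = 1"
    using t by (simp add: power_one_over field_simps)
  also have "(1 + real (n + 1) * (1 / t - 1)) * t ^ (n + 1) = (real n + 1) * t ^ n - real n * t ^ (n + 1)"
    using t by (simp add: field_simps)
  finally have key: "(real n + 1) * t ^ n - real n * t ^ (n + 1) \<le> 1" .
  have "real n * (s ^ n * (1 - s)) = m ^ (n + 1) * ((real n + 1) * t ^ n - real n * t ^ (n + 1))"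
  proof -
    have n: "real n = m * (real n + 1)" by (simp add: m_def)
    have "real n * (s ^ n * (1 - s)) = (m * (real n + 1)) * (m ^ n * t ^ n * (1 - m * t))"
      using n s by (simp add: power_mult_distrib)
    also have "\<dots> = m ^ (n + 1) * ((real n + 1) * t ^ n - (m * (real n + 1)) * t ^ (n + 1))"
      by (simp add: algebra_simps)
    finally show ?thesis using n by simp
  qed
  also have "\<dots> \<le> m ^ (n + 1) * 1"
    using key m by (intro mult_left_mono) auto
  finally show ?thesis by (simp add: m_def)
qed simp

text \<open>
  If \<open>s \<le> 1\<close> bounds \<open>\<delta>\<close> consecutive ratios, the next ratio is at most \<open>1 - c / s ^ \<delta>\<close>, and
  \<open>s - (1 - c / s ^ \<delta>) = (c - s ^ \<delta> * (1 - s)) / s ^ \<delta> \<ge> \<epsilon>\<close>. So the bound drops by at least \<open>\<epsilon>\<close>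
  every \<open>\<delta>\<close> steps, starting from 1, and becomes negative.
\<close>

lemma ratio_decay:
  fixes w :: "nat \<Rightarrow> real"
  assumes w: "\<And>i. 0 < w i" "\<And>i. w i < 1" and c: "0 < c"
    and rec: "\<And>i. w (i + \<delta>) = 1 - c / (\<Prod>j<\<delta>. w (i + j))"
    and gap: "\<And>s. 0 < s \<Longrightarrow> s ^ \<delta> * (1 - s) \<le> c - \<epsilon>" and "\<epsilon> > 0"
  shows False
proof -
  have "w i \<le> 1 - real k * \<epsilon>" if "k * \<delta> \<le> i" for k i
    using that
  proof (induction k arbitrary: i)
    case 0
    then show ?case using w(2)[of i] by simp
  next
    case (Suc k)
    define s where "s = 1 - real k * \<epsilon>"
    define j where "j = i - \<delta>"
    have j: "i = j + \<delta>" "k * \<delta> \<le> j" using Suc.prems by (auto simp: j_def)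
    have ws: "w (j + l) \<le> s" for l
      unfolding s_def using j by (intro Suc.IH) simp
    have s: "0 < s" "s \<le> 1" using ws[of 0] w(1)[of "j + 0"] \<open>\<epsilon> > 0\<close> by (auto simp: s_def)
    have "(\<Prod>l<\<delta>. w (j + l)) \<le> (\<Prod>l<\<delta>. s)"
      by (intro prod_mono) (use w(1) ws in \<open>auto intro: less_imp_le\<close>)
    then have prod: "(\<Prod>l<\<delta>. w (j + l)) \<le> s ^ \<delta>" by simp
    moreover have "0 < (\<Prod>l<\<delta>. w (j + l))" using w(1) by (intro prod_pos) auto
    ultimately have "w i \<le> 1 - c / s ^ \<delta>"
      using c j(1) rec[of j] by (simp add: frac_le)
    also have "\<dots> \<le> s - \<epsilon>"
    proof -
      have "s ^ \<delta> \<le> 1" using s by (simp add: power_le_one)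
      then have "\<epsilon> * s ^ \<delta> \<le> \<epsilon>" using \<open>\<epsilon> > 0\<close> by (simp add: mult_left_le)
      also have "\<dots> \<le> c - s ^ \<delta> * (1 - s)" using gap[OF s(1)] by simp
      finally show ?thesis using s by (simp add: field_simps)
    qed
    finally show ?case by (simp add: s_def algebra_simps)
  qed
  then have bound: "real k * \<epsilon> < 1" for k using w(1)[of "k * \<delta>"] by (smt (verit) order_refl)
  obtain k where "1 < real k * \<epsilon>" using reals_Archimedean3[OF \<open>\<epsilon> > 0\<close>] by blast
  then show False using bound[of k] by simp
qed

lemma positive_solutions_nonempty_iff:
  assumes "c > 0" and "\<delta> \<ge> 1"
  shows "positive_solutions c \<delta> \<noteq> {} \<longleftrightarrow> c * real \<delta> \<le> (real \<delta> / (real \<delta> + 1)) ^ (\<delta> + 1)"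
proof
  assume "positive_solutions c \<delta> \<noteq> {}"
  then obtain y where "y \<in> positive_solutions c \<delta>" by blast
  then have y: "\<And>i. 0 < y i" "\<And>i. y (Suc i) < y i"
      "\<And>i. y (Suc (i + \<delta>)) = y (i + \<delta>) - c * y i"
    using positive_solutions_iff[OF \<open>c > 0\<close>] by blast+
  define w where "w i = y (Suc i) / y i" for i
  define b where "b = (real \<delta> / (real \<delta> + 1)) ^ (\<delta> + 1)"
  define \<epsilon> where "\<epsilon> = c - b / real \<delta>"
  have prod: "(\<Prod>j<n. w (i + j)) = y (i + n) / y i" for i n
    using y(1)[THEN less_imp_neq] by (induction n) (auto simp: w_def field_simps)
  show "c * real \<delta> \<le> (real \<delta> / (real \<delta> + 1)) ^ (\<delta> + 1)"
  proof (rule ccontr)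
    assume "\<not> ?thesis"
    then have "b < c * real \<delta>" unfolding b_def by (simp only: not_le)
    then have "\<epsilon> > 0" using \<open>\<delta> \<ge> 1\<close> by (simp add: \<epsilon>_def field_simps)
    moreover have "w (i + \<delta>) = 1 - c / (\<Prod>j<\<delta>. w (i + j))" for i
      unfolding prod unfolding w_def using y(1)[of "i + \<delta>"] y(1)[of i] y(3)[of i]
      by (simp add: field_simps)
    moreover have "s ^ \<delta> * (1 - s) \<le> c - \<epsilon>" if "0 < s" for s
      using power_times_one_minus_le[OF that, of \<delta>, folded b_def] \<open>\<delta> \<ge> 1\<close>
      by (simp add: \<epsilon>_def field_simps)
    moreover have "0 < w i" "w i < 1" for i using y(1,2) by (auto simp: w_def)
    ultimately show False using ratio_decay[of w c \<delta> \<epsilon>] \<open>c > 0\<close> by blast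
  qed
next
  assume le: "c * real \<delta> \<le> (real \<delta> / (real \<delta> + 1)) ^ (\<delta> + 1)"
  define m where "m = real \<delta> / (real \<delta> + 1)"
  have m: "0 < m" "m < 1" using \<open>\<delta> \<ge> 1\<close> by (auto simp: m_def)
  have "real \<delta> * (m ^ \<delta> * (1 - m)) = m ^ (\<delta> + 1)"
    by (simp add: m_def field_simps)
  then have "real \<delta> * c \<le> real \<delta> * (m ^ \<delta> * (1 - m))"
    using le by (simp add: m_def mult.commute)
  then have "c \<le> m ^ \<delta> * (1 - m)" using \<open>\<delta> \<ge> 1\<close> by simp
  then have "\<exists>r\<ge>0. r \<le> m \<and> r ^ \<delta> * (1 - r) = c"
    using \<open>c > 0\<close> \<open>\<delta> \<ge> 1\<close> m by (intro IVT') (auto intro!: continuous_intros simp: zero_power)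
  then obtain r where r: "0 \<le> r" "r \<le> m" "r ^ \<delta> * (1 - r) = c" by blast
  have "r \<noteq> 0" using r(3) \<open>c > 0\<close> \<open>\<delta> \<ge> 1\<close> by (intro notI) (simp add: zero_power)
  then have "0 < r" "r < 1" using r(1,2) m by auto
  moreover have "r ^ Suc (Suc (i + \<delta>)) = r ^ Suc (i + \<delta>) - c * r ^ Suc i" for i
    by (simp add: r(3)[symmetric] power_add algebra_simps)
  \<comment> \<open>The exponent starts at 1 because the value at 0 has to lie below 1.\<close>
  ultimately have "(\<lambda>i. r ^ Suc i) \<in> positive_solutions c \<delta>"
    unfolding positive_solutions_iff[OF \<open>c > 0\<close>] by simp
  then show "positive_solutions c \<delta> \<noteq> {}" by blast
qed

section \<open>Distributions supported by the natural numbers\<close>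

context real_distribution
begin

lemma supp_cdf: "supp (cdf M) = {x. \<forall>\<epsilon>>0. 0 < prob {x - \<epsilon><..x + \<epsilon>}}"
  by (auto simp: supp_def cdf_diff_eq)

text \<open>
  The complement of the support is a union of open null sets, hence, by Lindelof, a countable one.
\<close>

lemma AE_in_supp: "AE x in M. x \<in> supp (cdf M)"
proof -
  let ?\<U> = "{U. open U \<and> prob U = 0}"
  obtain \<V> where \<V>: "\<V> \<subseteq> ?\<U>" "countable \<V>" "\<Union>\<V> = \<Union>?\<U>"
    by (rule Lindelof[of ?\<U>]) auto
  have "AE x in M. \<forall>U\<in>\<V>. x \<notin> U"
    unfolding AE_ball_countable[OF \<V>(2)]
  proof
    fix U assume "U \<in> \<V>"
    then have "open U" "prob U = 0" using \<V>(1) by auto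
    then show "AE x in M. x \<notin> U"
      by (intro AE_not_in null_setsI) (auto simp: emeasure_eq_measure)
  qed
  then show ?thesis
  proof eventually_elim
    case (elim x)
    show ?case
    proof (rule ccontr)
      assume "x \<notin> supp (cdf M)"
      then obtain \<epsilon> where \<epsilon>: "\<epsilon> > 0" "prob {x - \<epsilon><..x + \<epsilon>} = 0"
        unfolding supp_cdf by (auto simp: not_less measure_le_0_iff)
      have "prob {x - \<epsilon><..<x + \<epsilon>} \<le> prob {x - \<epsilon><..x + \<epsilon>}"
        by (intro finite_measure_mono) auto
      then have "{x - \<epsilon><..<x + \<epsilon>} \<in> ?\<U>" using \<epsilon> by (auto simp: measure_le_0_iff)
      then have "x \<in> \<Union>?\<U>" using \<epsilon>(1) by (intro UnionI[of "{x - \<epsilon><..<x + \<epsilon>}"]) auto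
      then show False using elim \<V>(3) by blast
    qed
  qed
qed

lemma supp_cdf_eq_Nats_iff:
  "supp (cdf M) = \<nat> \<longleftrightarrow> (AE x in M. x \<in> \<nat>) \<and> (\<forall>i. 0 < prob {real i})"
proof (intro iffI conjI allI)
  assume supp: "supp (cdf M) = \<nat>"
  show AE: "AE x in M. x \<in> \<nat>" using AE_in_supp supp by simp
  fix i
  have "prob {real i - 1/2<..real i + 1/2} = prob {real i}"
  proof (intro finite_measure_eq_AE)
    show "AE x in M. (x \<in> {real i - 1/2<..real i + 1/2}) = (x \<in> {real i})"
      using AE
    proof eventually_elim
      case (elim x)
      then obtain k where "x = real k" by (auto elim: Nats_cases)
      then show ?case by auto
    qed
  qed auto
  moreover have "real i \<in> supp (cdf M)" by (simp add: supp)
  then have "0 < prob {real i - 1/2<..real i + 1/2}"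
    unfolding supp_cdf by (metis (mono_tags) half_gt_zero_iff mem_Collect_eq zero_less_one)
  ultimately show "0 < prob {real i}" by simp
next
  assume asm: "(AE x in M. x \<in> \<nat>) \<and> (\<forall>i. 0 < prob {real i})"
  show "supp (cdf M) = \<nat>"
  proof (intro equalityI subsetI)
    fix x :: real assume "x \<in> \<nat>"
    then obtain i where i: "x = real i" by (auto elim: Nats_cases)
    have "0 < prob {x - \<epsilon><..x + \<epsilon>}" if "\<epsilon> > 0" for \<epsilon>
    proof -
      have "prob {real i} \<le> prob {x - \<epsilon><..x + \<epsilon>}"
        using that i by (intro finite_measure_mono) auto
      then show ?thesis using asm by (metis less_le_trans)
    qed
    then show "x \<in> supp (cdf M)" by (simp add: supp_cdf)
  next
    fix x assume x: "x \<in> supp (cdf M)"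
    show "x \<in> \<nat>"
    proof (rule ccontr)
      assume "x \<notin> \<nat>"
      then obtain e where e: "e > 0" "ball x e \<subseteq> - \<nat>"
        using closed_Nats[where 'a = real] open_contains_ball[of "- \<nat> :: real set"]
        by (auto simp: closed_def)
      have "{x - e/2<..x + e/2} \<subseteq> ball x e" by (auto simp: dist_real_def)
      then have *: "{x - e/2<..x + e/2} \<inter> \<nat> = {}" using e by blast
      have "prob {x - e/2<..x + e/2} = prob {}"
      proof (intro finite_measure_eq_AE)
        show "AE y in M. (y \<in> {x - e/2<..x + e/2}) = (y \<in> {})"
          using conjunct1[OF asm] by eventually_elim (use * in blast)
      qed auto
      then show False using x e(1) unfolding supp_cdf
        by (metis (mono_tags) half_gt_zero measure_empty mem_Collect_eq order_less_irrefl)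
    qed
  qed
qed

lemma one_minus_cdf: "1 - cdf M x = prob {x<..}"
proof -
  have "prob (space M - {..x}) = 1 - prob {..x}" by (intro prob_compl) auto
  moreover have "space M - {..x} = {x<..}" by auto
  ultimately show ?thesis by (simp add: cdf_def)
qed

text \<open>
  A distribution function with support \<open>\<nat>\<close> is determined by its values on \<open>\<nat>\<close>; this is what makes
  the map \<open>F \<mapsto> 1 - F\<close>, restricted to integer arguments, injective.
\<close>

lemma cdf_eq_of_AE_Nats:
  assumes "AE x in M. x \<in> \<nat>"
  shows "cdf M x = (if x < 0 then 0 else cdf M (real (nat \<lfloor>x\<rfloor>)))"
proof (cases "x < 0")
  case True
  have "prob {..x} = prob {}"
  proof (intro finite_measure_eq_AE)
    show "AE y in M. (y \<in> {..x}) = (y \<in> {})"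
      using assms by eventually_elim (use True in \<open>auto elim: Nats_cases\<close>)
  qed auto
  then show ?thesis using True by (simp add: cdf_def)
next
  case False
  have "prob {..x} = prob {..real (nat \<lfloor>x\<rfloor>)}"
  proof (intro finite_measure_eq_AE)
    show "AE y in M. (y \<in> {..x}) = (y \<in> {..real (nat \<lfloor>x\<rfloor>)})"
      using assms
    proof eventually_elim
      case (elim y)
      then obtain k where "y = real k" by (auto elim: Nats_cases)
      moreover have "real k \<le> x \<longleftrightarrow> k \<le> nat \<lfloor>x\<rfloor>" using False by linarith
      ultimately show ?case by simp
    qed
  qed auto
  then show ?thesis using False by (simp add: cdf_def)
qed

end

section \<open>The compensated record gain\<close>

text \<open>
  The increment of \<open>N - c M\<close> caused by the observation \<open>x\<close> when the current maximum is \<open>m\<close>.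
\<close>

definition record_gain :: "real \<Rightarrow> real \<Rightarrow> real \<Rightarrow> real \<Rightarrow> real" where
  "record_gain c \<delta> m x = (if x > m + \<delta> then 1 else 0) - c * max (x - m) 0"

lemma record_gain_measurable [measurable]: "record_gain c \<delta> m \<in> borel_measurable borel"
  unfolding record_gain_def by measurable

lemma (in prob_space) integrable_record_gain:
  assumes "integrable M f" and [measurable]: "g \<in> borel_measurable M" and "integrable M g"
  shows "integrable M (\<lambda>x. record_gain c \<delta> (g x) (f x))"
proof -
  have [measurable]: "f \<in> borel_measurable M" using assms(1) by simp
  have "integrable M (\<lambda>x. if f x > g x + \<delta> then 1 else 0 :: real)"
    by (rule integrable_const_bound[where B = 1]) auto
  then show ?thesis
    unfolding record_gain_def using assms by (intro Bochner_Integration.integrable_diff integrable_mult_right integrable_max) auto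
qed

context real_distribution
begin

text \<open>
  Restricting to two neighbouring integer levels turns the positive parts into a tail event: for
  integers \<open>k\<close>, \<open>(k - i)\<^sup>+ - (k - (i + 1))\<^sup>+ = 1{k > i}\<close>.
\<close>

lemma expectation_record_gain_diff:
  assumes Nats: "AE x in M. x \<in> \<nat>" and int: "integrable M (\<lambda>x. x)"
  shows "(\<integral>x. record_gain c (real \<delta>) (real i) x \<partial>M) - (\<integral>x. record_gain c (real \<delta>) (real (Suc i)) x \<partial>M)
    = (1 - cdf M (real (i + \<delta>))) - (1 - cdf M (real (Suc (i + \<delta>)))) - c * (1 - cdf M (real i))"
proof -
  have gain: "integrable M (record_gain c (real \<delta>) (real k))" for k
    using integrable_record_gain[OF int, of "\<lambda>_. real k" c "real \<delta>"] by simp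
  have "(\<integral>x. record_gain c (real \<delta>) (real i) x \<partial>M) - (\<integral>x. record_gain c (real \<delta>) (real (Suc i)) x \<partial>M)
    = (\<integral>x. record_gain c (real \<delta>) (real i) x - record_gain c (real \<delta>) (real (Suc i)) x \<partial>M)"
    by (intro Bochner_Integration.integral_diff[symmetric] gain)
  also have "\<dots> = (\<integral>x. indicator {real (i + \<delta>)<..} x - indicator {real (Suc (i + \<delta>))<..} x
      - c * indicator {real i<..} x \<partial>M)"
  proof (rule integral_cong_AE)
    show "AE x in M. record_gain c (real \<delta>) (real i) x - record_gain c (real \<delta>) (real (Suc i)) x
      = indicator {real (i + \<delta>)<..} x - indicator {real (Suc (i + \<delta>))<..} x
        - c * indicator {real i<..} x"
      using Nats
    proof eventually_elim
      case (elim x)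
      then obtain k where k: "x = real k" by (auto elim: Nats_cases)
      have "max (real k - real i) 0 = max (real k - real (Suc i)) 0 + indicator {real i<..} (real k)"
        by (auto simp: indicator_def)
      then have "record_gain c (real \<delta>) (real i) x - record_gain c (real \<delta>) (real (Suc i)) x
        = (if real k > real i + real \<delta> then 1 else 0) - (if real k > real (Suc i) + real \<delta> then 1 else 0)
           - c * indicator {real i<..} (real k)"
        unfolding k record_gain_def by (simp only:) (simp add: algebra_simps)
      then show ?case unfolding k by (auto simp: indicator_def)
    qed
  qed auto
  also have "\<dots> = prob {real (i + \<delta>)<..} - prob {real (Suc (i + \<delta>))<..} - c * prob {real i<..}"
    by (subst Bochner_Integration.integral_diff Bochner_Integration.integral_mult_right
        | simp add: emeasure_eq_measure)+
  finally show ?thesis by (simp add: one_minus_cdf)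
qed

text \<open>
  For each \<open>x\<close> the gain vanishes once the level exceeds \<open>x\<close>; finiteness of the mean provides the
  dominating function.
\<close>

lemma expectation_record_gain_tendsto_0:
  assumes int: "integrable M (\<lambda>x. x)"
  shows "(\<lambda>i. \<integral>x. record_gain c (real \<delta>) (real i) x \<partial>M) \<longlonglongrightarrow> 0"
proof -
  have "(\<lambda>i. \<integral>x. record_gain c (real \<delta>) (real i) x \<partial>M) \<longlonglongrightarrow> (\<integral>x. 0 \<partial>M)"
  proof (rule integral_dominated_convergence[where w = "\<lambda>x. 1 + \<bar>c\<bar> * \<bar>x\<bar>"])
    show "integrable M (\<lambda>x. 1 + \<bar>c\<bar> * \<bar>x\<bar>)"
      using integrable_abs[OF int] by simp
    show "AE x in M. (\<lambda>i. record_gain c (real \<delta>) (real i) x) \<longlonglongrightarrow> 0"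
    proof (rule AE_I2)
      fix x
      have "record_gain c (real \<delta>) (real i) x = 0" if "nat \<lceil>x\<rceil> \<le> i" for i
      proof -
        have "x \<le> real i" using that by linarith
        then show ?thesis by (simp add: record_gain_def)
      qed
      then show "(\<lambda>i. record_gain c (real \<delta>) (real i) x) \<longlonglongrightarrow> 0"
        by (intro tendsto_eventually eventually_sequentiallyI)
    qed
    show "AE x in M. norm (record_gain c (real \<delta>) (real i) x) \<le> 1 + \<bar>c\<bar> * \<bar>x\<bar>" for i
    proof (rule AE_I2)
      fix x
      have "\<bar>max (x - real i) 0\<bar> \<le> \<bar>x\<bar>" by auto
      then have "\<bar>c * max (x - real i) 0\<bar> \<le> \<bar>c\<bar> * \<bar>x\<bar>"
        unfolding abs_mult by (intro mult_left_mono) auto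
      then show "norm (record_gain c (real \<delta>) (real i) x) \<le> 1 + \<bar>c\<bar> * \<bar>x\<bar>"
        by (auto simp: record_gain_def)
    qed
  qed auto
  then show ?thesis by simp
qed

text \<open>
  The difference equation makes the mean gain constant in the level, and the constant is its limit 0.
\<close>

lemma expectation_record_gain_zero_iff:
  assumes Nats: "AE x in M. x \<in> \<nat>" and int: "integrable M (\<lambda>x. x)"
  defines "y \<equiv> \<lambda>i. 1 - cdf M (real i)"
  shows "(\<forall>i. (\<integral>x. record_gain c (real \<delta>) (real i) x \<partial>M) = 0) \<longleftrightarrow>
    (\<forall>i. y (Suc (i + \<delta>)) = y (i + \<delta>) - c * y i)"
proof
  assume zero: "\<forall>i. (\<integral>x. record_gain c (real \<delta>) (real i) x \<partial>M) = 0"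
  show "\<forall>i. y (Suc (i + \<delta>)) = y (i + \<delta>) - c * y i"
  proof
    fix i
    show "y (Suc (i + \<delta>)) = y (i + \<delta>) - c * y i"
      using expectation_record_gain_diff[OF Nats int, of c \<delta> i]
        zero[rule_format, of i] zero[rule_format, of "Suc i"] unfolding y_def by linarith
  qed
next
  define e where "e i = (\<integral>x. record_gain c (real \<delta>) (real i) x \<partial>M)" for i
  assume rec: "\<forall>i. y (Suc (i + \<delta>)) = y (i + \<delta>) - c * y i"
  have "e (Suc i) = e i" for i
    using expectation_record_gain_diff[OF Nats int, of c \<delta> i] rec[rule_format, of i]
    unfolding y_def e_def by linarith
  then have "e i = e 0" for i by (induction i) auto
  then have "e = (\<lambda>_. e 0)" by blast
  moreover have "e \<longlonglongrightarrow> 0"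
    using expectation_record_gain_tendsto_0[OF int] unfolding e_def .
  ultimately have "e 0 = 0" by (metis LIMSEQ_unique tendsto_const)
  then show "\<forall>i. (\<integral>x. record_gain c (real \<delta>) (real i) x \<partial>M) = 0"
    using \<open>\<And>i. e i = e 0\<close> by (simp add: e_def)
qed

end

section \<open>The martingale property of an i.i.d. sequence\<close>

lemma space_generated_filtration [simp]: "space (generated_filtration M X n) = space M"
  unfolding generated_filtration_def by (rule space_measure_of) auto

lemma sets_generated_filtration:
  "sets (generated_filtration M X n) =
    sigma_sets (space M) (\<Union>i\<in>{1..n}. {X i -` B \<inter> space M |B. B \<in> sets borel})"
  unfolding generated_filtration_def by (rule sets_measure_of) auto

lemma sets_generated_filtration_mono:
  "m \<le> n \<Longrightarrow> sets (generated_filtration M X m) \<subseteq> sets (generated_filtration M X n)"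
  unfolding sets_generated_filtration by (intro sigma_sets_mono' UN_mono) auto

lemma coordinate_measurable_generated_filtration:
  assumes "i \<in> {1..n}"
  shows "X i \<in> borel_measurable (generated_filtration M X n)"
proof (rule measurableI)
  fix B :: "real set" assume "B \<in> sets borel"
  then have "X i -` B \<inter> space M \<in> (\<Union>i\<in>{1..n}. {X i -` B \<inter> space M |B. B \<in> sets borel})"
    using assms by blast
  then show "X i -` B \<inter> space (generated_filtration M X n) \<in> sets (generated_filtration M X n)"
    by (auto simp: sets_generated_filtration)
qed simp

text \<open>
  This is how independence of the past is used: an event of the past is a function of the vector
  \<open>(X 1, \<dots>, X n)\<close>, which is independent of \<open>X (n + 1)\<close>.
\<close>

lemma generated_filtration_preimage:
  assumes "A \<in> sets (generated_filtration M X n)"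
  obtains B where "B \<in> sets (Pi\<^sub>M {1..n} (\<lambda>_. borel))"
    "A = (\<lambda>\<omega>. restrict (\<lambda>i. X i \<omega>) {1..n}) -` B \<inter> space M"
proof -
  let ?V = "vimage_algebra (space M) (\<lambda>\<omega>. restrict (\<lambda>i. X i \<omega>) {1..n}) (Pi\<^sub>M {1..n} (\<lambda>_. borel :: real measure))"
  have V: "sets ?V = {(\<lambda>\<omega>. restrict (\<lambda>i. X i \<omega>) {1..n}) -` B \<inter> space M |B. B \<in> sets (Pi\<^sub>M {1..n} (\<lambda>_. borel))}"
    by (rule sets_vimage_algebra2) (auto simp: space_PiM)
  have "sets (generated_filtration M X n) \<subseteq> sets ?V"
    unfolding sets_generated_filtration
  proof (rule sets.sigma_sets_subset')
    show "(\<Union>i\<in>{1..n}. {X i -` B \<inter> space M |B. B \<in> sets borel}) \<subseteq> sets ?V"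
    proof clarify
      fix i B assume i: "i \<in> {1..n}" and B: "B \<in> sets (borel :: real measure)"
      have "(\<lambda>f. f i) -` B \<inter> space (Pi\<^sub>M {1..n} (\<lambda>_. borel)) \<in> sets (Pi\<^sub>M {1..n} (\<lambda>_. borel :: real measure))"
        using i B by (intro measurable_sets[OF measurable_component_singleton]) auto
      moreover have "X i -` B \<inter> space M = (\<lambda>\<omega>. restrict (\<lambda>i. X i \<omega>) {1..n}) -`
          ((\<lambda>f. f i) -` B \<inter> space (Pi\<^sub>M {1..n} (\<lambda>_. borel))) \<inter> space M"
        using i by (auto simp: space_PiM)
      ultimately show "X i -` B \<inter> space M \<in> sets ?V" unfolding V by blast
    qed
    show "space M \<in> sets ?V" using sets.top[of ?V] by simp
  qed
  then show thesis using assms V that by blast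
qed

lemma running_max_Suc:
  "n \<ge> 1 \<Longrightarrow> running_max X (Suc n) \<omega> = max (running_max X n \<omega>) (X (Suc n) \<omega>)"
  by (simp add: running_max_def atLeastAtMostSuc_conv max.commute)

lemma delta_record_count_Suc:
  assumes "n \<ge> 1"
  shows "(delta_record_count \<delta> X (Suc n) \<omega> - c * running_max X (Suc n) \<omega>)
    - (delta_record_count \<delta> X n \<omega> - c * running_max X n \<omega>)
    = record_gain c \<delta> (running_max X n \<omega>) (X (Suc n) \<omega>)"
  using assms unfolding running_max_Suc[OF assms]
  by (auto simp: delta_record_count_def delta_record_ind_def record_gain_def max_def algebra_simps)

lemma running_max_measurable:
  assumes "\<And>i. i \<in> {1..n} \<Longrightarrow> X i \<in> borel_measurable N"
  shows "running_max X n \<in> borel_measurable N"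
  unfolding running_max_def[abs_def] using assms by (intro borel_measurable_Max) auto

lemma delta_record_count_measurable:
  assumes "\<And>i. i \<in> {1..n} \<Longrightarrow> X i \<in> borel_measurable N"
  shows "delta_record_count \<delta> X n \<in> borel_measurable N"
  unfolding delta_record_count_def[abs_def]
proof (intro borel_measurable_sum)
  fix k assume k: "k \<in> {1..n}"
  show "delta_record_ind \<delta> X k \<in> borel_measurable N"
  proof (cases "k = 1")
    case False
    have [measurable]: "X k \<in> borel_measurable N" "running_max X (k - 1) \<in> borel_measurable N"
      using k by (auto intro!: assms running_max_measurable)
    show ?thesis using False unfolding delta_record_ind_def[abs_def] by (simp only: if_False) measurable
  qed (simp add: delta_record_ind_def[abs_def])
qed

locale iid_sequence = prob_space M for M :: "'a measure" +
  fixes X :: "nat \<Rightarrow> 'a \<Rightarrow> real" and \<mu> :: "real measure"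
  assumes indep: "indep_vars (\<lambda>_. borel) X {1..}"
    and distr_eq: "n \<ge> 1 \<Longrightarrow> distr M borel (X n) = \<mu>"
    and integrable_law: "integrable \<mu> (\<lambda>x. x)"
begin

abbreviation (input) compensated :: "real \<Rightarrow> real \<Rightarrow> nat \<Rightarrow> 'a \<Rightarrow> real" where
  "compensated c \<delta> n \<omega> \<equiv> delta_record_count \<delta> X n \<omega> - c * running_max X n \<omega>"

lemma X_measurable [measurable]: "n \<ge> 1 \<Longrightarrow> X n \<in> borel_measurable M"
  using indep by (simp add: indep_vars_def)

lemma law: "real_distribution \<mu>"
proof -
  have "real_distribution (distr M borel (X 1))" by (intro real_distribution_distr) simp
  then show ?thesis by (simp add: distr_eq)
qed

sublocale law: real_distribution \<mu> by (rule law)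

lemma X_integrable: "n \<ge> 1 \<Longrightarrow> integrable M (X n)"
  by (rule integrable_distr[of "X n" M borel "\<lambda>x. x"]) (simp_all add: distr_eq integrable_law)

lemma AE_X:
  assumes "n \<ge> 1" "AE x in \<mu>. Q x"
  shows "AE \<omega> in M. Q (X n \<omega>)"
  using assms(2) unfolding distr_eq[OF assms(1), symmetric]
  by (rule AE_distrD[rotated]) (use assms(1) in simp)

lemma subalgebra_generated_filtration: "subalgebra M (generated_filtration M X n)"
  unfolding subalgebra_def
proof (intro conjI subsetI)
  fix A assume "A \<in> sets (generated_filtration M X n)"
  then obtain B where B: "B \<in> sets (Pi\<^sub>M {1..n} (\<lambda>_. borel))"
      "A = (\<lambda>\<omega>. restrict (\<lambda>i. X i \<omega>) {1..n}) -` B \<inter> space M"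
    by (rule generated_filtration_preimage)
  have "(\<lambda>\<omega>. restrict (\<lambda>i. X i \<omega>) {1..n}) \<in> measurable M (Pi\<^sub>M {1..n} (\<lambda>_. borel))"
    by (intro measurable_restrict) auto
  then show "A \<in> sets M" unfolding B(2) using B(1) by (rule measurable_sets)
qed simp

lemma integral_future_over_past:
  assumes A: "A \<in> sets (generated_filtration M X n)"
    and int: "integrable \<mu> h"
  shows "(\<integral>\<omega>\<in>A. h (X (Suc n) \<omega>) \<partial>M) = prob A * (\<integral>x. h x \<partial>\<mu>)"
proof -
  obtain B where B: "B \<in> sets (Pi\<^sub>M {1..n} (\<lambda>_. borel))"
      "A = (\<lambda>\<omega>. restrict (\<lambda>i. X i \<omega>) {1..n}) -` B \<inter> space M"
    using A by (rule generated_filtration_preimage)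
  have AM: "A \<in> sets M" using A subalgebra_generated_filtration by (auto simp: subalgebra_def)
  have h: "h \<in> borel_measurable borel" using int by (auto dest: borel_measurable_integrable)
  have "indep_var (Pi\<^sub>M {1..n} (\<lambda>_. borel)) (\<lambda>\<omega>. restrict (\<lambda>i. X i \<omega>) {1..n})
      (Pi\<^sub>M {Suc n} (\<lambda>_. borel)) (\<lambda>\<omega>. restrict (\<lambda>i. X i \<omega>) {Suc n})"
    by (rule indep_var_restrict[OF indep]) auto
  moreover have "(\<lambda>f. h (f (Suc n))) \<in> borel_measurable (Pi\<^sub>M {Suc n} (\<lambda>_. borel))"
    by (rule measurable_compose[OF measurable_component_singleton[where M = "\<lambda>_. borel"] h]) simp
  moreover have "indicat_real B \<in> borel_measurable (Pi\<^sub>M {1..n} (\<lambda>_. borel))"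
    using B by (intro borel_measurable_indicator)
  ultimately have "indep_var borel (indicat_real B \<circ> (\<lambda>\<omega>. restrict (\<lambda>i. X i \<omega>) {1..n}))
      borel ((\<lambda>f. h (f (Suc n))) \<circ> (\<lambda>\<omega>. restrict (\<lambda>i. X i \<omega>) {Suc n}))"
    by (intro indep_var_compose)
  also have "(\<lambda>f. h (f (Suc n))) \<circ> (\<lambda>\<omega>. restrict (\<lambda>i. X i \<omega>) {Suc n}) = (\<lambda>\<omega>. h (X (Suc n) \<omega>))"
    by auto
  finally have ind: "indep_var borel (indicat_real B \<circ> (\<lambda>\<omega>. restrict (\<lambda>i. X i \<omega>) {1..n}))
      borel (\<lambda>\<omega>. h (X (Suc n) \<omega>))" .
  let ?I = "indicat_real B \<circ> (\<lambda>\<omega>. restrict (\<lambda>i. X i \<omega>) {1..n})"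
  have I: "?I \<omega> = indicator A \<omega>" if "\<omega> \<in> space M" for \<omega>
    using that by (auto simp: B(2) indicator_def)
  have intI: "integrable M ?I"
    using AM by (subst Bochner_Integration.integrable_cong[OF refl I]) (auto simp: emeasure_eq_measure)
  have inth: "integrable M (\<lambda>\<omega>. h (X (Suc n) \<omega>))"
    by (rule integrable_distr[of "X (Suc n)" M borel h]) (simp_all add: distr_eq int)
  have "(\<integral>\<omega>\<in>A. h (X (Suc n) \<omega>) \<partial>M) = (\<integral>\<omega>. ?I \<omega> * h (X (Suc n) \<omega>) \<partial>M)"
    unfolding set_lebesgue_integral_def by (intro Bochner_Integration.integral_cong[OF refl]) (simp only: I real_scaleR_def)
  also have "\<dots> = (\<integral>\<omega>. ?I \<omega> \<partial>M) * (\<integral>\<omega>. h (X (Suc n) \<omega>) \<partial>M)"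
    by (rule indep_var_lebesgue_integral[OF ind intI inth])
  also have "(\<integral>\<omega>. ?I \<omega> \<partial>M) = prob A"
    using AM by (subst Bochner_Integration.integral_cong[OF refl I]) auto
  also have "(\<integral>\<omega>. h (X (Suc n) \<omega>) \<partial>M) = (\<integral>x. h x \<partial>\<mu>)"
    using h integral_distr[of "X (Suc n)" M borel h] distr_eq[of "Suc n"] by simp
  finally show ?thesis .
qed

lemma integrable_running_max: "n \<ge> 1 \<Longrightarrow> integrable M (running_max X n)"
proof (induction n rule: nat_induct_at_least)
  case base
  then show ?case using X_integrable[of 1] by (simp add: running_max_def[abs_def])
next
  case (Suc n)
  then have "running_max X (Suc n) = (\<lambda>\<omega>. max (running_max X n \<omega>) (X (Suc n) \<omega>))"
    by (intro ext running_max_Suc)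
  then show ?case using Suc X_integrable[of "Suc n"] by simp
qed

lemma integrable_compensated:
  assumes "n \<ge> 1"
  shows "integrable M (compensated c \<delta> n)"
proof (intro Bochner_Integration.integrable_diff integrable_mult_right integrable_running_max assms)
  have "delta_record_count \<delta> X n \<in> borel_measurable M"
    by (intro delta_record_count_measurable) auto
  moreover have "\<bar>delta_record_count \<delta> X n \<omega>\<bar> \<le> real n" for \<omega>
  proof -
    have "\<bar>delta_record_count \<delta> X n \<omega>\<bar> \<le> (\<Sum>k = 1..n. \<bar>delta_record_ind \<delta> X k \<omega>\<bar>)"
      unfolding delta_record_count_def by (rule sum_abs)
    also have "\<dots> \<le> (\<Sum>k = 1..n. 1)"
      by (intro sum_mono) (auto simp: delta_record_ind_def)
    finally show ?thesis by simp
  qed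
  ultimately show "integrable M (delta_record_count \<delta> X n)"
    by (intro integrable_const_bound[where B = "real n"]) auto
qed

lemma set_integral_compensated_Suc_diff:
  assumes "n \<ge> 1" "A \<in> sets M"
  shows "(\<integral>\<omega>\<in>A. compensated c \<delta> (Suc n) \<omega> \<partial>M) - (\<integral>\<omega>\<in>A. compensated c \<delta> n \<omega> \<partial>M)
    = (\<integral>\<omega>\<in>A. record_gain c \<delta> (running_max X n \<omega>) (X (Suc n) \<omega>) \<partial>M)"
proof -
  have "set_integrable M A (compensated c \<delta> k)" if "k \<ge> 1" for k
    unfolding set_integrable_def
    by (intro integrable_mult_indicator assms integrable_compensated that)
  then show ?thesis
    using assms(1) by (subst set_integral_diff(2)[symmetric]) (auto simp: delta_record_count_Suc)
qed

text \<open>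
  On an event where the maximum is constant, the increment is a function of the new observation
  alone, so that independence of the past applies.
\<close>

lemma set_integral_gain_at_level:
  assumes A: "A \<in> sets (generated_filtration M X n)"
    and level: "\<And>\<omega>. \<omega> \<in> A \<Longrightarrow> running_max X n \<omega> = m"
  shows "(\<integral>\<omega>\<in>A. record_gain c \<delta> (running_max X n \<omega>) (X (Suc n) \<omega>) \<partial>M)
    = prob A * (\<integral>x. record_gain c \<delta> m x \<partial>\<mu>)"
proof -
  have "(\<integral>\<omega>\<in>A. record_gain c \<delta> (running_max X n \<omega>) (X (Suc n) \<omega>) \<partial>M)
      = (\<integral>\<omega>\<in>A. record_gain c \<delta> m (X (Suc n) \<omega>) \<partial>M)"
    unfolding set_lebesgue_integral_def
    by (intro Bochner_Integration.integral_cong) (auto simp: indicator_def level)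
  also have "\<dots> = prob A * (\<integral>x. record_gain c \<delta> m x \<partial>\<mu>)"
    using law.integrable_record_gain[OF integrable_law, of "\<lambda>_. m"]
    by (intro integral_future_over_past[OF A]) simp
  finally show ?thesis .
qed

lemma AE_running_max_Nats:
  assumes "AE x in \<mu>. x \<in> \<nat>" "n \<ge> 1"
  shows "AE \<omega> in M. running_max X n \<omega> \<in> \<nat>"
proof -
  have "AE \<omega> in M. \<forall>i\<in>{1..n}. X i \<omega> \<in> \<nat>"
    by (intro AE_finite_allI AE_X assms(1)) auto
  then show ?thesis
  proof eventually_elim
    case (elim \<omega>)
    have "running_max X n \<omega> \<in> (\<lambda>i. X i \<omega>) ` {1..n}"
      unfolding running_max_def using assms(2) by (intro Max_in) auto
    then show ?case using elim by auto
  qed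
qed

text \<open>
  As the maximum is almost surely an integer, the event splits into countably many pieces on each of
  which the maximum is constant.
\<close>

lemma set_integral_gain_eq_0:
  assumes Nats: "AE x in \<mu>. x \<in> \<nat>" and "n \<ge> 1"
    and zero: "\<And>i. (\<integral>x. record_gain c \<delta> (real i) x \<partial>\<mu>) = 0"
    and A: "A \<in> sets (generated_filtration M X n)"
  shows "(\<integral>\<omega>\<in>A. record_gain c \<delta> (running_max X n \<omega>) (X (Suc n) \<omega>) \<partial>M) = 0"
proof -
  let ?G = "\<lambda>\<omega>. record_gain c \<delta> (running_max X n \<omega>) (X (Suc n) \<omega>)"
  define level where "level i = A \<inter> {\<omega> \<in> space M. running_max X n \<omega> = real i}" for i
  have sub: "sets (generated_filtration M X n) \<subseteq> sets M"
    using subalgebra_generated_filtration by (auto simp: subalgebra_def)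
  have [measurable]: "running_max X n \<in> borel_measurable (generated_filtration M X n)"
    by (intro running_max_measurable coordinate_measurable_generated_filtration)
  have "{\<omega> \<in> space (generated_filtration M X n). running_max X n \<omega> = real i}
      \<in> sets (generated_filtration M X n)" for i
    by measurable
  then have level: "level i \<in> sets (generated_filtration M X n)" for i
    unfolding level_def using A by auto
  then have levelM: "level i \<in> sets M" for i using sub by blast
  have AM: "A \<in> sets M" using A sub by blast
  have [measurable]: "running_max X n \<in> borel_measurable M" "X (Suc n) \<in> borel_measurable M"
    by (auto intro!: running_max_measurable)
  have intG: "integrable M ?G"
    using assms(2) by (intro integrable_record_gain X_integrable integrable_running_max) auto
  have zero_level: "(\<integral>\<omega>\<in>level i. ?G \<omega> \<partial>M) = 0" for i
    using set_integral_gain_at_level[OF level, of i "real i" c \<delta>] zero by (simp add: level_def)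
  have "(\<integral>\<omega>\<in>A. ?G \<omega> \<partial>M) = (\<integral>\<omega>\<in>(\<Union>i. level i). ?G \<omega> \<partial>M)"
    unfolding set_lebesgue_integral_def
  proof (rule integral_cong_AE)
    show "(\<lambda>\<omega>. indicat_real A \<omega> *\<^sub>R ?G \<omega>) \<in> borel_measurable M"
      using intG AM by (intro borel_measurable_integrable integrable_mult_indicator)
    show "(\<lambda>\<omega>. indicat_real (\<Union>i. level i) \<omega> *\<^sub>R ?G \<omega>) \<in> borel_measurable M"
      using intG levelM by (intro borel_measurable_integrable integrable_mult_indicator) auto
    show "AE \<omega> in M. indicat_real A \<omega> *\<^sub>R ?G \<omega> = indicat_real (\<Union>i. level i) \<omega> *\<^sub>R ?G \<omega>"
      using AE_running_max_Nats[OF Nats \<open>n \<ge> 1\<close>] AE_space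
    proof eventually_elim
      case (elim \<omega>)
      then obtain k where "running_max X n \<omega> = real k" by (auto elim: Nats_cases)
      then have "\<omega> \<in> A \<longleftrightarrow> \<omega> \<in> (\<Union>i. level i)" using elim by (auto simp: level_def)
      then show ?case by (simp add: indicator_def)
    qed
  qed
  also have "\<dots> = (\<Sum>i. \<integral>\<omega>\<in>level i. ?G \<omega> \<partial>M)"
  proof (rule lebesgue_integral_countable_add)
    show "set_integrable M (\<Union>i. level i) ?G"
      unfolding set_integrable_def using intG levelM by (intro integrable_mult_indicator) auto
  qed (auto simp: levelM, auto simp: level_def)
  finally show ?thesis by (simp add: zero_level)
qed

text \<open>
  The step from time 1 to time 2 suffices: the maximum at time 1 is \<open>X 1\<close>, which hits every atom
  with positive probability.
\<close>

lemma martingale_imp_expected_gain_0: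
  assumes mart: "martingale_on M {1..} (generated_filtration M X) (\<lambda>n. compensated c \<delta> n)"
    and atom: "measure \<mu> {m} > 0"
  shows "(\<integral>x. record_gain c \<delta> m x \<partial>\<mu>) = 0"
proof -
  let ?F = "generated_filtration M X 1"
  interpret F: finite_measure_subalgebra M ?F
    by unfold_locales (rule subalgebra_generated_filtration)
  define A where "A = {\<omega> \<in> space M. X 1 \<omega> = m}"
  have [measurable]: "X 1 \<in> borel_measurable ?F"
    by (intro coordinate_measurable_generated_filtration) auto
  have "{\<omega> \<in> space ?F. X 1 \<omega> = m} \<in> sets ?F" by measurable
  then have A: "A \<in> sets ?F" by (simp add: A_def)
  then have AM: "A \<in> sets M" using subalgebra_generated_filtration[of 1] by (auto simp: subalgebra_def)
  have "prob A = measure (distr M borel (X 1)) {m}"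
    by (subst measure_distr) (auto simp: A_def vimage_def intro!: arg_cong[where f = prob])
  then have "prob A > 0" using atom by (simp add: distr_eq)
  have mart_step: "AE \<omega> in M. real_cond_exp M ?F (compensated c \<delta> 2) \<omega> = compensated c \<delta> 1 \<omega>"
    using mart unfolding martingale_on_def by auto
  have "(\<integral>\<omega>\<in>A. compensated c \<delta> 2 \<omega> \<partial>M) = (\<integral>\<omega>\<in>A. real_cond_exp M ?F (compensated c \<delta> 2) \<omega> \<partial>M)"
    by (rule F.real_cond_exp_intA[OF integrable_compensated A]) simp
  also have "\<dots> = (\<integral>\<omega>\<in>A. compensated c \<delta> 1 \<omega> \<partial>M)"
  proof (rule set_lebesgue_integral_cong_AE)
    show "AE \<omega>\<in>A in M. real_cond_exp M ?F (compensated c \<delta> 2) \<omega> = compensated c \<delta> 1 \<omega>"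
      using mart_step by eventually_elim simp
    show "compensated c \<delta> 1 \<in> borel_measurable M"
      by (intro borel_measurable_integrable integrable_compensated) simp
  qed (use AM in auto)
  finally have "0 = prob A * (\<integral>x. record_gain c \<delta> m x \<partial>\<mu>)"
    using set_integral_compensated_Suc_diff[of 1 A \<delta> c] AM
      set_integral_gain_at_level[OF A, of m c \<delta>]
    by (simp add: A_def running_max_def numeral_2_eq_2)
  then show ?thesis using \<open>prob A > 0\<close> by simp
qed

lemma expected_gain_0_imp_martingale:
  assumes Nats: "AE x in \<mu>. x \<in> \<nat>"
    and zero: "\<And>i. (\<integral>x. record_gain c \<delta> (real i) x \<partial>\<mu>) = 0"
  shows "martingale_on M {1..} (generated_filtration M X) (\<lambda>n. compensated c \<delta> n)"
  unfolding martingale_on_def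
proof (intro conjI ballI impI)
  fix n :: nat assume "n \<in> {1..}"
  then show "integrable M (compensated c \<delta> n)" by (intro integrable_compensated) simp
next
  fix n :: nat
  have [measurable]: "running_max X n \<in> borel_measurable (generated_filtration M X n)"
    "delta_record_count \<delta> X n \<in> borel_measurable (generated_filtration M X n)"
    by (auto intro!: running_max_measurable delta_record_count_measurable
        coordinate_measurable_generated_filtration)
  show "compensated c \<delta> n \<in> borel_measurable (generated_filtration M X n)" by measurable
  interpret F: finite_measure_subalgebra M "generated_filtration M X n"
    by unfold_locales (rule subalgebra_generated_filtration)
  fix k assume n: "n \<in> {1..}" and "k \<in> {1..}" "n \<le> k"
  show "AE \<omega> in M. real_cond_exp M (generated_filtration M X n) (compensated c \<delta> k) \<omega>
    = compensated c \<delta> n \<omega>"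
  proof (rule F.real_cond_exp_charact)
    fix A assume A: "A \<in> sets (generated_filtration M X n)"
    show "(\<integral>\<omega>\<in>A. compensated c \<delta> k \<omega> \<partial>M) = (\<integral>\<omega>\<in>A. compensated c \<delta> n \<omega> \<partial>M)"
      using \<open>n \<le> k\<close>
    proof (induction k rule: dec_induct)
      case (step k)
      have Ak: "A \<in> sets (generated_filtration M X k)"
        using A sets_generated_filtration_mono[OF step.hyps(1)] by blast
      then have "A \<in> sets M" using subalgebra_generated_filtration[of k] by (auto simp: subalgebra_def)
      then show ?case
        using set_integral_compensated_Suc_diff[of k A \<delta> c] n step
          set_integral_gain_eq_0[OF Nats _ zero Ak] by simp
    qed simp
  qed (use n \<open>k \<in> {1..}\<close> in \<open>auto intro!: integrable_compensated\<close>)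
qed (auto intro: subalgebra_generated_filtration dest: subsetD[OF sets_generated_filtration_mono])

end

section \<open>Distribution functions and positive solutions\<close>

text \<open>
  This removes the i.i.d. sequence from the definition: only the law of a single observation
  remains. A sequence with a given law is realised by the coordinates of a product measure.
\<close>

lemma mem_P_iff:
  assumes supp: "supp F = \<nat>"
  shows "F \<in> P c \<delta> \<longleftrightarrow> (\<exists>\<mu>. real_distribution \<mu> \<and> cdf \<mu> = F \<and> integrable \<mu> (\<lambda>x. x) \<and>
    (\<forall>i. (\<integral>x. record_gain c \<delta> (real i) x \<partial>\<mu>) = 0))"
proof
  assume "F \<in> P c \<delta>"
  then obtain M :: "(nat \<Rightarrow> real) measure" and X where iid: "iid_with_cdf M X F"
    and int: "\<And>n. n \<ge> 1 \<Longrightarrow> integrable M (X n)"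
    and mart: "martingale_on M {1..} (generated_filtration M X)
          (\<lambda>n \<omega>. delta_record_count \<delta> X n \<omega> - c * running_max X n \<omega>)"
    unfolding P_def by auto
  interpret prob_space M using iid by (simp add: iid_with_cdf_def)
  have rv: "X n \<in> borel_measurable M" if "n \<ge> 1" for n
    using int[OF that] by simp
  have law: "real_distribution (distr M borel (X n))" if "n \<ge> 1" for n
    using rv[OF that] by (rule real_distribution_distr)
  have cdf: "cdf (distr M borel (X n)) = F" if "n \<ge> 1" for n
    using iid that by (simp add: iid_with_cdf_def)
  define \<mu> where "\<mu> = distr M borel (X 1)"
  interpret iid_sequence M X \<mu>
  proof
    show "indep_vars (\<lambda>_. borel) X {1..}" using iid by (simp add: iid_with_cdf_def)
    show "distr M borel (X n) = \<mu>" if "n \<ge> 1" for n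
      unfolding \<mu>_def using that by (intro cdf_unique law) (auto simp: cdf)
    show "integrable \<mu> (\<lambda>x. x)"
      unfolding \<mu>_def using int[of 1] rv[of 1] by (subst integrable_distr_eq) auto
  qed
  have "cdf \<mu> = F" unfolding \<mu>_def by (rule cdf) simp
  then have "measure \<mu> {real i} > 0" for i
    using law.supp_cdf_eq_Nats_iff supp by blast
  then have "(\<integral>x. record_gain c \<delta> (real i) x \<partial>\<mu>) = 0" for i
    using martingale_imp_expected_gain_0[OF mart] by blast
  then show "\<exists>\<mu>. real_distribution \<mu> \<and> cdf \<mu> = F \<and> integrable \<mu> (\<lambda>x. x) \<and>
    (\<forall>i. (\<integral>x. record_gain c \<delta> (real i) x \<partial>\<mu>) = 0)"
    using law.real_distribution_axioms \<open>cdf \<mu> = F\<close> integrable_law by blast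
next
  assume "\<exists>\<mu>. real_distribution \<mu> \<and> cdf \<mu> = F \<and> integrable \<mu> (\<lambda>x. x) \<and>
    (\<forall>i. (\<integral>x. record_gain c \<delta> (real i) x \<partial>\<mu>) = 0)"
  then obtain \<mu> where \<mu>: "real_distribution \<mu>" and cdf: "cdf \<mu> = F" and int: "integrable \<mu> (\<lambda>x. x)"
    and zero: "\<And>i. (\<integral>x. record_gain c \<delta> (real i) x \<partial>\<mu>) = 0"
    by blast
  interpret \<mu>: real_distribution \<mu> by (rule \<mu>)
  have Nats: "AE x in \<mu>. x \<in> \<nat>" and atom: "\<And>i. 0 < measure \<mu> {real i}"
    using supp \<mu>.supp_cdf_eq_Nats_iff cdf by auto
  define M :: "(nat \<Rightarrow> real) measure" where "M = Pi\<^sub>M UNIV (\<lambda>_. \<mu>)"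
  define X :: "nat \<Rightarrow> (nat \<Rightarrow> real) \<Rightarrow> real" where "X n \<omega> = \<omega> n" for n \<omega>
  interpret M: prob_space M
    unfolding M_def by (intro prob_space_PiM \<mu>.prob_space_axioms)
  have rv: "X n \<in> borel_measurable M" for n
  proof -
    have "(\<lambda>\<omega>. \<omega> n) \<in> measurable M \<mu>" unfolding M_def by (rule measurable_component_singleton) simp
    then show ?thesis unfolding X_def[abs_def] by (simp cong: measurable_cong_sets)
  qed
  have marginal: "distr M borel (X n) = \<mu>" for n
  proof -
    have "distr M borel (X n) = distr M \<mu> (\<lambda>\<omega>. \<omega> n)"
      by (rule distr_cong) (auto simp: X_def)
    also have "\<dots> = \<mu>"
      unfolding M_def by (rule distr_PiM_component) (auto intro: \<mu>.prob_space_axioms)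
    finally show ?thesis .
  qed
  have indep: "M.indep_vars (\<lambda>_. borel) X {1..}"
  proof (subst M.indep_vars_iff_distr_eq_PiM)
    have "distr M (Pi\<^sub>M {1..} (\<lambda>_. borel)) (\<lambda>\<omega>. \<lambda>i\<in>{1..}. X i \<omega>)
        = distr M (Pi\<^sub>M {1..} (\<lambda>_. \<mu>)) (\<lambda>\<omega>. \<lambda>i\<in>{1..}. \<omega> i)"
      by (rule distr_cong) (auto simp: X_def intro!: sets_PiM_cong)
    also have "\<dots> = Pi\<^sub>M {1..} (\<lambda>_. \<mu>)"
      unfolding M_def
      by (rule distr_PiM_reindex[of UNIV "\<lambda>_. \<mu>" "\<lambda>i. i" "{1..}"]) (auto intro: \<mu>.prob_space_axioms)
    finally show "distr M (Pi\<^sub>M {1..} (\<lambda>_. borel)) (\<lambda>\<omega>. \<lambda>i\<in>{1..}. X i \<omega>)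
        = (\<Pi>\<^sub>M i\<in>{1..}. distr M borel (X i))"
      by (simp add: marginal)
  qed (auto intro: rv)
  interpret iid_sequence M X \<mu>
    by unfold_locales (rule indep marginal int)+
  \<comment> \<open>A one-point distribution would have \<open>F 0 \<in> {0, 1}\<close>, but both 0 and 1 are atoms.\<close>
  have "nondegenerate F"
    unfolding nondegenerate_def
  proof
    assume "\<exists>a. \<forall>x. F x = (if x < a then 0 else 1)"
    then have "cdf \<mu> 0 = 0 \<or> cdf \<mu> 0 = 1" unfolding cdf by metis
    moreover have "measure \<mu> {0} \<le> measure \<mu> {..0}" "measure \<mu> {1} \<le> measure \<mu> {0<..}"
      by (auto intro!: \<mu>.finite_measure_mono)
    then have "0 < cdf \<mu> 0" "0 < 1 - cdf \<mu> 0"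
      using atom[of 0] atom[of 1] \<mu>.one_minus_cdf[of 0] by (auto simp: cdf_def)
    ultimately show False by auto
  qed
  moreover have "iid_with_cdf M X F"
    using M.prob_space_axioms indep by (simp add: iid_with_cdf_def marginal cdf)
  moreover have "\<forall>n\<ge>1. integrable M (X n)" using X_integrable by blast
  moreover have "martingale_on M {1..} (generated_filtration M X)
      (\<lambda>n \<omega>. delta_record_count \<delta> X n \<omega> - c * running_max X n \<omega>)"
    by (rule expected_gain_0_imp_martingale[OF Nats zero])
  ultimately show "F \<in> P c \<delta>" unfolding P_def by blast
qed

lemma (in real_distribution) survival_strictly_decreasing:
  assumes "supp (cdf M) = \<nat>"
  shows "0 < 1 - cdf M (real i)" "cdf M (real 0) > 0"
    "1 - cdf M (real (Suc i)) < 1 - cdf M (real i)"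
proof -
  have atom: "0 < prob {real k}" for k using assms supp_cdf_eq_Nats_iff by blast
  have *: "prob {real (Suc i)} \<le> prob {real i<..}" "prob {real 0} \<le> prob {..real 0}"
    "prob {real (Suc i)} \<le> prob {real i<..real (Suc i)}"
    by (auto intro!: finite_measure_mono)
  then show "0 < 1 - cdf M (real i)" "cdf M (real 0) > 0"
    "1 - cdf M (real (Suc i)) < 1 - cdf M (real i)"
    using atom[of 0] atom[of "Suc i"] cdf_diff_eq[of "real i" "real (Suc i)"] *
      one_minus_cdf[of "real i"] cdf_def2[of M "real 0"]
    by (simp_all del: of_nat_Suc of_nat_0)
qed

lemma survival_mem_positive_solutions_iff:
  assumes "c > 0" and supp: "supp F = \<nat>" and \<mu>: "real_distribution \<mu>" "cdf \<mu> = F" "integrable \<mu> (\<lambda>x. x)"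
  shows "(\<lambda>i. 1 - F (real i)) \<in> positive_solutions c \<delta> \<longleftrightarrow> F \<in> P c (real \<delta>)"
proof -
  interpret real_distribution \<mu> by (rule \<mu>(1))
  have Nats: "AE x in \<mu>. x \<in> \<nat>" using supp_cdf_eq_Nats_iff \<mu>(2) supp by blast
  have "(\<lambda>i. 1 - F (real i)) \<in> positive_solutions c \<delta> \<longleftrightarrow>
      (\<forall>i. (\<integral>x. record_gain c (real \<delta>) (real i) x \<partial>\<mu>) = 0)"
    unfolding positive_solutions_iff[OF \<open>c > 0\<close>]
      expectation_record_gain_zero_iff[OF Nats \<mu>(3)] \<mu>(2)
    using survival_strictly_decreasing[unfolded \<mu>(2), OF supp] by (auto simp del: of_nat_Suc)
  also have "\<dots> \<longleftrightarrow> F \<in> P c (real \<delta>)"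
    unfolding mem_P_iff[OF supp] using \<mu> cdf_unique by blast
  finally show ?thesis .
qed

text \<open>
  The atom at \<open>i\<close> is \<open>y(i - 1) - y(i)\<close>, with \<open>y(-1) = 1\<close>. The mean of an \<open>\<nat>\<close>-valued variable is the
  sum of its tail probabilities, so summability of \<open>y\<close> yields both total mass 1, through
  \<open>y \<longlonglongrightarrow> 0\<close>, and a finite mean.
\<close>

lemma distribution_of_survival_sequence:
  fixes y :: "nat \<Rightarrow> real"
  assumes pos: "\<And>i. 0 < y i" and y0: "y 0 < 1" and dec: "\<And>i. y (Suc i) < y i" and sum: "summable y"
  obtains \<mu> where "real_distribution \<mu>" "supp (cdf \<mu>) = \<nat>" "\<And>i. 1 - cdf \<mu> (real i) = y i"
    "integrable \<mu> (\<lambda>x. x)"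
proof -
  define p where "p i = (case i of 0 \<Rightarrow> 1 - y 0 | Suc j \<Rightarrow> y j - y (Suc j))" for i
  have p_pos: "0 < p i" for i using y0 dec by (auto simp: p_def split: nat.split)
  have p_sum: "(\<Sum>k\<le>i. p k) = 1 - y i" for i
    by (induction i) (auto simp: p_def)
  have "(\<lambda>n. \<Sum>k<Suc n. p k) \<longlonglongrightarrow> 1 - 0"
    unfolding lessThan_Suc_atMost p_sum
    by (intro tendsto_diff tendsto_const summable_LIMSEQ_zero sum)
  then have "p sums 1" unfolding sums_def by (subst (asm) filterlim_sequentially_Suc) simp
  then have "(\<integral>\<^sup>+i. p i \<partial>count_space UNIV) = 1"
    using p_pos by (subst nn_integral_count_space_nat, subst suminf_ennreal_eq) (auto intro: less_imp_le)
  then have pmf: "pmf (embed_pmf p) i = p i" for i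
    using p_pos by (intro pmf_embed_pmf) (auto intro: less_imp_le)
  define Q where "Q = measure_pmf (embed_pmf p)"
  define \<mu> where "\<mu> = distr Q borel real"
  have distribution: "measure \<mu> A = measure Q {k. real k \<in> A}" if "A \<in> sets borel" for A
    unfolding \<mu>_def using that by (subst measure_distr) (auto simp: Q_def vimage_def)
  interpret Q: prob_space Q unfolding Q_def by (rule measure_pmf.prob_space_axioms)
  interpret \<mu>: real_distribution \<mu>
    unfolding \<mu>_def by (rule Q.real_distribution_distr) (simp add: Q_def)
  have cdf: "cdf \<mu> (real i) = 1 - y i" for i
  proof -
    have "cdf \<mu> (real i) = measure Q {..i}"
      by (simp add: cdf_def distribution atMost_def)
    also have "\<dots> = (\<Sum>k\<le>i. p k)"
      unfolding Q_def by (subst measure_measure_pmf_finite) (auto simp: pmf)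
    finally show ?thesis by (simp add: p_sum)
  qed
  have "measure \<mu> {real i} = p i" for i
    by (simp add: distribution Q_def measure_pmf_single pmf)
  moreover have "AE x in \<mu>. x \<in> \<nat>"
    unfolding \<mu>_def by (subst AE_distr_iff) (auto simp: Q_def)
  ultimately have "supp (cdf \<mu>) = \<nat>"
    using \<mu>.supp_cdf_eq_Nats_iff p_pos by simp
  moreover have "integrable \<mu> (\<lambda>x. x)"
  proof -
    have "emeasure Q {k \<in> space Q. t < k} = ennreal (y t)" for t
    proof -
      have "measure \<mu> {real t<..} = measure Q {k. t < k}" by (simp add: distribution)
      then show ?thesis using \<mu>.one_minus_cdf[of "real t"] cdf[of t]
        by (simp add: Q.emeasure_eq_measure) (simp add: Q_def)
    qed
    then have "(\<integral>\<^sup>+k. of_nat k \<partial>Q) = (\<Sum>t. ennreal (y t))"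
      using nn_integral_nat_function[of "\<lambda>k. k" Q] by (simp add: Q_def)
    also have "\<dots> < \<infinity>"
    proof -
      have "(\<Sum>t. ennreal (y t)) \<noteq> top"
        by (rule ennreal_suminf_neq_top[OF sum]) (rule less_imp_le[OF pos])
      then show ?thesis by (simp add: top.not_eq_extremum)
    qed
    finally have "integrable Q real"
      by (intro integrableI_nonneg) (auto simp: Q_def ennreal_of_nat_eq_real_of_nat)
    then show ?thesis
      unfolding \<mu>_def by (subst integrable_distr_eq) (auto simp: Q_def)
  qed
  ultimately show thesis using that[of \<mu>] \<mu>.real_distribution_axioms cdf by simp
qed

lemma P_distribution:
  assumes "F \<in> P c \<delta>" "supp F = \<nat>"
  obtains \<mu> where "real_distribution \<mu>" "cdf \<mu> = F" "integrable \<mu> (\<lambda>x. x)"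
  using assms mem_P_iff by blast

theorem theorem11:
  fixes c :: real and \<delta> :: nat
  assumes "c > 0" and "\<delta> \<ge> 1"
  shows "bij_betw (\<lambda>F i. 1 - F (real i))
           {F \<in> P c (real \<delta>). supp F = \<nat>} (positive_solutions c \<delta>) \<and>
         (\<not> (\<exists>F \<in> P c (real \<delta>). supp F = \<nat>) \<longleftrightarrow>
           c * real \<delta> > (real \<delta> / (real \<delta> + 1)) ^ (\<delta> + 1))"
proof -
  let ?S = "\<lambda>F i. 1 - F (real i) :: real"
  let ?D = "{F \<in> P c (real \<delta>). supp F = \<nat>}"
  have "inj_on ?S ?D"
  proof (rule inj_onI)
    fix F G assume F: "F \<in> ?D" and G: "G \<in> ?D" and eq: "?S F = ?S G"
    have floor: "H x = (if x < 0 then 0 else H (real (nat \<lfloor>x\<rfloor>)))" if "H \<in> ?D" for H x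
    proof -
      obtain \<mu> where \<mu>: "real_distribution \<mu>" "cdf \<mu> = H"
        using P_distribution[of H c "real \<delta>"] \<open>H \<in> ?D\<close> by blast
      interpret real_distribution \<mu> by (rule \<mu>(1))
      show ?thesis using cdf_eq_of_AE_Nats[of x] supp_cdf_eq_Nats_iff \<open>H \<in> ?D\<close> \<mu>(2) by blast
    qed
    have "F (real i) = G (real i)" for i using fun_cong[OF eq, of i] by simp
    then show "F = G" using floor[OF F] floor[OF G] by (intro ext) metis
  qed
  moreover have "?S ` ?D = positive_solutions c \<delta>"
  proof (intro equalityI subsetI)
    fix y assume "y \<in> ?S ` ?D"
    then obtain F where F: "F \<in> P c (real \<delta>)" "supp F = \<nat>" "y = ?S F" by blast
    obtain \<mu> where "real_distribution \<mu>" "cdf \<mu> = F" "integrable \<mu> (\<lambda>x. x)"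
      using P_distribution[OF F(1,2)] .
    then show "y \<in> positive_solutions c \<delta>"
      using survival_mem_positive_solutions_iff[OF \<open>c > 0\<close> F(2)] F by blast
  next
    fix y assume y: "y \<in> positive_solutions c \<delta>"
    then have "\<And>i. 0 < y i" "y 0 < 1" "\<And>i. y (Suc i) < y i"
      using positive_solutions_iff[OF \<open>c > 0\<close>] by blast+
    then obtain \<mu> where \<mu>: "real_distribution \<mu>" "supp (cdf \<mu>) = \<nat>" "\<And>i. 1 - cdf \<mu> (real i) = y i"
      "integrable \<mu> (\<lambda>x. x)"
      using positive_solution_summable[OF \<open>c > 0\<close> y] distribution_of_survival_sequence[of y] by blast
    have "?S (cdf \<mu>) = y" using \<mu>(3) by blast
    moreover from this have "cdf \<mu> \<in> P c (real \<delta>)"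
      using survival_mem_positive_solutions_iff[OF \<open>c > 0\<close> \<mu>(2,1) refl \<mu>(4)] y by simp
    ultimately show "y \<in> ?S ` ?D" using \<mu>(2) by blast
  qed
  ultimately have bij: "bij_betw ?S ?D (positive_solutions c \<delta>)" unfolding bij_betw_def by blast
  then have "?D = {} \<longleftrightarrow> positive_solutions c \<delta> = {}" by (auto simp: bij_betw_def)
  then have "\<not> (\<exists>F \<in> P c (real \<delta>). supp F = \<nat>) \<longleftrightarrow>
      c * real \<delta> > (real \<delta> / (real \<delta> + 1)) ^ (\<delta> + 1)"
    using positive_solutions_nonempty_iff[OF assms] by (metis (mono_tags, lifting) Collect_empty_eq not_le)
  with bij show ?thesis by blast
qed

end
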